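(* Let $\mathcal C^m=\bigcap_{k=0}^{m-1}\ker(\omega_k)$ be the Cartan distribution on $J^m(E)$. Then $\mathcal C^m$ is never involutive for any finite $m\ge 1$. More precisely, $$d\omega_{m-1}=d\theta\wedge ds_m\not\equiv 0\quad \text{mod }\{\omega_0,\dots,\omega_{m-1}\},$$ so that $\mathcal C^m$ fails the Frobenius involutivity condition.
   Context: Let $\mathcal H=L^2(\mu)$ be a nonzero (real) Hilbert space and $E=\mathbb R\times\mathcal H\to\mathbb R$ the trivial bundle, $(\theta,s)\mapsto\theta$. The $m$-jet bundle is $J^m(E)=\mathbb R\times\mathcal H^{m+1}$ with coordinates $(\theta,s,s_1,\dots,s_m)$, $s,s_k\in\mathcal H$, and $s_0=s$. The contact $1$-forms on $J^m(E)$ are the ($\mathcal H$-valued) forms $$\omega_k=ds_k-s_{k+1}\,d\theta,\qquad k=0,\dots,m-1.$$ The Cartan distribution $\mathcal C^m\subset TJ^m(E)$ is defined as their common kernel. A $2$-form is $\equiv 0$ mod $\{\omega_0,\dots,\omega_{m-1}\}$ if it lies in the ideal generated by these forms; for $\mathcal H$-valued forms this is understood as vanishing on all pairs of vectors in $\mathcal C^m$. A distribution is involutive if the Lie bracket of any two smooth vector fields taking values in it again takes values in it. *)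

theory Defs
  imports "HOL-Analysis.Analysis"
begin

section \<open>Calculus on a Banach space\<close>

text \<open>
  All manifolds below are Banach spaces \<open>'p\<close>, whose tangent spaces are identified with \<open>'p\<close>.

  \<open>D vs p\<close> is the iterated derivative of \<open>f\<close> at \<open>p\<close> evaluated on the list \<open>vs\<close>, its length being the
  order. The last clause requires the \<open>n\<close>-th derivative, as a map into the \<open>n\<close>-linear maps with the
  operator norm, to be Frechet differentiable. The iterated derivatives cannot be
  formed by recursion on \<open>n\<close>, because their codomain would be a type depending on \<open>n\<close>.
\<close>

definition smooth_map :: "('a::banach \<Rightarrow> 'b::banach) \<Rightarrow> bool" where
  "smooth_map f \<longleftrightarrow> (\<exists>D :: 'a list \<Rightarrow> 'a \<Rightarrow> 'b.
     D [] = f \<and>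
     (\<forall>vs p. (D vs has_derivative (\<lambda>u. D (u # vs) p)) (at p)) \<and>
     (\<forall>n p. \<forall>\<epsilon>>0. \<exists>\<delta>>0. \<forall>h. norm h < \<delta> \<longrightarrow>
        (\<forall>vs. length vs = n \<and> (\<forall>v\<in>set vs. norm v \<le> 1) \<longrightarrow>
           norm (D vs (p + h) - D vs p - D (h # vs) p) \<le> \<epsilon> * norm h)))"

definition lie_bracket :: "('p::banach \<Rightarrow> 'p) \<Rightarrow> ('p \<Rightarrow> 'p) \<Rightarrow> 'p \<Rightarrow> 'p" where
  "lie_bracket X Y p = frechet_derivative Y (at p) (X p) - frechet_derivative X (at p) (Y p)"

definition involutive :: "('p::banach \<Rightarrow> 'p set) \<Rightarrow> bool" where
  "involutive \<Delta> \<longleftrightarrow>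
     (\<forall>X Y. smooth_map X \<and> smooth_map Y \<and> (\<forall>p. X p \<in> \<Delta> p) \<and> (\<forall>p. Y p \<in> \<Delta> p)
        \<longrightarrow> (\<forall>p. lie_bracket X Y p \<in> \<Delta> p))"

type_synonym ('p, 'v) form1 = "'p \<Rightarrow> 'p \<Rightarrow>\<^sub>L 'v"
type_synonym ('p, 'v) form2 = "'p \<Rightarrow> 'p \<Rightarrow> 'p \<Rightarrow> 'v"

text \<open>The forms are vector valued. Exterior derivative and wedge product are normalised without the
  factor \<open>1/2\<close>.\<close>

definition ext_d0 :: "('p::banach \<Rightarrow> 'v::banach) \<Rightarrow> ('p, 'v) form1" where
  "ext_d0 f p = Blinfun (frechet_derivative f (at p))"

definition ext_d1 :: "('p::banach, 'v::banach) form1 \<Rightarrow> ('p, 'v) form2" where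
  "ext_d1 \<alpha> p u v = blinfun_apply (frechet_derivative \<alpha> (at p) u) v
                 - blinfun_apply (frechet_derivative \<alpha> (at p) v) u"

definition wedge :: "('p::banach, real) form1 \<Rightarrow> ('p, 'v::banach) form1 \<Rightarrow> ('p, 'v) form2" where
  "wedge \<alpha> \<beta> p u v = blinfun_apply (\<alpha> p) u *\<^sub>R blinfun_apply (\<beta> p) v
                  - blinfun_apply (\<alpha> p) v *\<^sub>R blinfun_apply (\<beta> p) u"

definition common_kernel :: "('p::banach, 'v::banach) form1 set \<Rightarrow> 'p \<Rightarrow> 'p set" where
  "common_kernel F p = {v. \<forall>\<alpha>\<in>F. blinfun_apply (\<alpha> p) v = 0}"

definition zero_mod :: "('p::banach, 'v::banach) form2 \<Rightarrow> ('p, 'v) form1 set \<Rightarrow> bool" where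
  "zero_mod \<Omega> F \<longleftrightarrow> (\<forall>p. \<forall>u\<in>common_kernel F p. \<forall>v\<in>common_kernel F p. \<Omega> p u v = 0)"


section \<open>The jet bundle\<close>

text \<open>
  The \<open>m\<close>-jet space \<open>\<real> \<times> H\<^bsup>m+1\<^esup>\<close> is \<open>('h, 'n) jet\<close> for a type \<open>'n\<close> with \<open>m + 1\<close> elements, enumerated
  by a bijection \<open>e\<close> from \<open>{0..m}\<close>; the \<open>k\<close>-th coordinate \<open>s\<^sub>k\<close> is the component with index \<open>e k\<close>.
\<close>

type_synonym ('h, 'n) jet = "real \<times> ('h ^ 'n)"

definition jet_theta :: "('h::{real_inner,banach}, 'n::finite) jet \<Rightarrow> real" where
  "jet_theta p = fst p"

definition jet_s :: "(nat \<Rightarrow> 'n::finite) \<Rightarrow> nat \<Rightarrow> ('h::{real_inner,banach}, 'n) jet \<Rightarrow> 'h" where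
  "jet_s e k p = snd p $ e k"

definition contact_form ::
    "(nat \<Rightarrow> 'n::finite) \<Rightarrow> nat \<Rightarrow> (('h::{real_inner,banach}, 'n) jet, 'h) form1" where
  "contact_form e k p =
     ext_d0 (jet_s e k) p - (blinfun_scaleR_left (jet_s e (Suc k) p) o\<^sub>L ext_d0 jet_theta p)"

definition contact_forms ::
    "(nat \<Rightarrow> 'n::finite) \<Rightarrow> nat \<Rightarrow> (('h::{real_inner,banach}, 'n) jet, 'h) form1 set" where
  "contact_forms e m = {contact_form e k |k. k < m}"

definition cartan_distribution ::
    "(nat \<Rightarrow> 'n::finite) \<Rightarrow> nat \<Rightarrow> ('h::{real_inner,banach}, 'n) jet \<Rightarrow> ('h, 'n) jet set" where
  "cartan_distribution e m = common_kernel (contact_forms e m)"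

end

theory Submission
  imports Defs
begin

text \<open>
  Non-involutivity is witnessed by the total derivative
  \<open>X = \<partial>\<^sub>\<theta> + s\<^sub>1 \<partial>\<^sub>s\<^sub>0 + \<dots> + s\<^sub>m \<partial>\<^sub>s\<^sub>m\<^sub>-\<^sub>1\<close> and, for a vector \<open>x \<noteq> 0\<close>, the constant field \<open>Y\<close> with value
  \<open>x\<close> in the top slot \<open>s\<^sub>m\<close>. Both lie in the Cartan distribution, but \<open>[X, Y]\<close> is the constant field
  with value \<open>- x\<close> in the slot \<open>s\<^sub>m\<^sub>-\<^sub>1\<close>, on which \<open>\<omega>\<^sub>m\<^sub>-\<^sub>1\<close> does not vanish. The same two vectors at a
  single point show that \<open>d\<theta> \<and> ds\<^sub>m\<close> does not vanish on the distribution.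
\<close>

lemma has_derivative_affine:
  assumes "bounded_linear L"
  shows "((\<lambda>p. c + L p) has_derivative L) (at p)"
  using has_derivative_add[OF has_derivative_const bounded_linear_imp_has_derivative[OF assms]]
  by simp

lemma frechet_derivative_bounded_linear:
  "bounded_linear f \<Longrightarrow> frechet_derivative f (at p) = f"
  by (metis bounded_linear_imp_has_derivative frechet_derivative_at)

text \<open>The derivatives are \<open>L\<close> at order one and zero from order two on, so the
  remainder in \<open>smooth_map\<close> vanishes identically and any positive \<delta>
  serves.\<close>

lemma smooth_map_affine:
  fixes L :: "'a::banach \<Rightarrow> 'b::banach"
  assumes L: "bounded_linear L"
  shows "smooth_map (\<lambda>p. c + L p)"
proof -
  define D :: "'a list \<Rightarrow> 'a \<Rightarrow> 'b" where
    "D = (\<lambda>vs p. case vs of [] \<Rightarrow> c + L p | [v] \<Rightarrow> L v | _ \<Rightarrow> 0)"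
  interpret bounded_linear L by (fact L)
  have "(D vs has_derivative (\<lambda>u. D (u # vs) p)) (at p)" for vs p
    by (cases vs) (auto simp: D_def has_derivative_affine[OF L] split: list.splits)
  moreover have "D vs (p + h) - D vs p - D (h # vs) p = 0" for vs p h
    by (auto simp: D_def add split: list.splits)
  ultimately show ?thesis
    unfolding smooth_map_def
    by (intro exI[of _ D]) (auto simp: D_def intro!: exI[of _ 1])
qed

text \<open>A constant second field has zero derivative; only the term differentiating the affine
  field along \<open>y\<close> survives.\<close>

lemma lie_bracket_affine:
  assumes "bounded_linear L"
  shows "lie_bracket (\<lambda>p. c + L p) (\<lambda>_. y) p = - L y"
  using frechet_derivative_at[OF has_derivative_affine[OF assms, of c p], symmetric]
  by (simp add: lie_bracket_def)

lemma bounded_linear_axis: "bounded_linear (axis i :: 'a::real_normed_vector \<Rightarrow> 'a ^ 'n::finite)"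
proof
  show "\<exists>K. \<forall>x::'a. norm (axis i x :: 'a ^ 'n) \<le> norm x * K"
  proof (intro exI allI)
    fix x :: 'a
    \<comment> \<open>The l2 norm is at most the l1 norm, which has a single nonzero term
      here.\<close>
    have "norm (axis i x :: 'a ^ 'n) \<le> (\<Sum>j\<in>UNIV. norm (axis i x $ j :: 'a))"
      by (simp add: norm_vec_def L2_set_le_sum)
    also have "\<dots> = (\<Sum>j\<in>UNIV. if j = i then norm x else 0)"
      by (intro sum.cong) (auto simp: axis_def)
    finally show "norm (axis i x :: 'a ^ 'n) \<le> norm x * 1" by simp
  qed
qed (auto simp: vec_eq_iff axis_def)

lemma blinfun_apply_ext_d0:
  "bounded_linear f \<Longrightarrow> blinfun_apply (ext_d0 f p) = f"
  by (simp add: ext_d0_def frechet_derivative_bounded_linear bounded_linear_Blinfun_apply)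

lemma bounded_linear_jet_theta: "bounded_linear jet_theta"
  unfolding jet_theta_def by (rule bounded_linear_fst)

lemma bounded_linear_jet_s: "bounded_linear (jet_s e k)"
  unfolding jet_s_def
  by (rule bounded_linear_compose[OF bounded_linear_vec_nth bounded_linear_snd])

text \<open>The coordinates are bounded linear, hence equal to their own differentials.\<close>

lemma contact_form_apply:
  "blinfun_apply (contact_form e k p) v = jet_s e k v - jet_theta v *\<^sub>R jet_s e (Suc k) p"
  by (simp add: contact_form_def blinfun.diff_left blinfun_apply_ext_d0
      bounded_linear_jet_theta bounded_linear_jet_s)

lemma cartan_distribution_iff:
  "v \<in> cartan_distribution e m p \<longleftrightarrow>
     (\<forall>k<m. jet_s e k v = jet_theta v *\<^sub>R jet_s e (Suc k) p)"
  by (auto simp: cartan_distribution_def common_kernel_def contact_forms_def contact_form_apply)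

text \<open>The term \<open>ds_k\<close> is constant, hence closed. The other term contributes
  \<open>- ds_(k+1)\<close> wedge \<open>d\<theta>\<close>, and antisymmetry absorbs the
  sign.\<close>

lemma ext_d1_contact_form:
  "ext_d1 (contact_form e k) = wedge (ext_d0 jet_theta) (ext_d0 (jet_s e (Suc k)))"
proof (intro ext)
  fix p u v :: "('a, 'b) jet"
  define T :: "('a, 'b) jet \<Rightarrow>\<^sub>L real" where "T = ext_d0 jet_theta p"
  define C :: "('a, 'b) jet \<Rightarrow>\<^sub>L 'a" where "C = ext_d0 (jet_s e k) p"
  \<comment> \<open>\<open>T\<close> and \<open>C\<close> do not depend on the base point, so the
    form is affine in \<open>q\<close> with linear part \<open>M\<close>, which is therefore its
    derivative.\<close>
  define M :: "('a, 'b) jet \<Rightarrow> ('a, 'b) jet \<Rightarrow>\<^sub>L 'a"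
    where "M = (\<lambda>q. - (blinfun_scaleR_left (jet_s e (Suc k) q) o\<^sub>L T))"
  have "bounded_linear M"
    unfolding M_def
    by (intro bounded_linear_minus
        bounded_linear_compose[OF bounded_bilinear.bounded_linear_left[OF bounded_bilinear_blinfun_compose]]
        bounded_linear_compose[OF bounded_linear_blinfun_scaleR_left] bounded_linear_jet_s)
  moreover have "contact_form e k = (\<lambda>q. C + M q)"
    by (intro ext blinfun_eqI) (simp add: C_def M_def T_def contact_form_apply
        blinfun.diff_left blinfun_apply_ext_d0 bounded_linear_jet_theta bounded_linear_jet_s)
  ultimately have "frechet_derivative (contact_form e k) (at p) = M"
    using frechet_derivative_at[OF has_derivative_affine] by metis
  then show "ext_d1 (contact_form e k) p u v
      = wedge (ext_d0 jet_theta) (ext_d0 (jet_s e (Suc k))) p u v"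
    by (simp add: ext_d1_def wedge_def M_def T_def blinfun.minus_left blinfun_apply_ext_d0
        bounded_linear_jet_theta bounded_linear_jet_s)
qed

text \<open>The linear part of the total derivative.\<close>

definition jet_shift ::
    "(nat \<Rightarrow> 'n::finite) \<Rightarrow> nat \<Rightarrow> ('h::{real_inner,banach}, 'n) jet \<Rightarrow> ('h, 'n) jet" where
  "jet_shift e m p = (0, \<Sum>k<m. axis (e k) (jet_s e (Suc k) p))"

lemma bounded_linear_jet_shift: "bounded_linear (jet_shift e m)"
  unfolding jet_shift_def
  by (intro bounded_linear_Pair bounded_linear_zero bounded_linear_sum
      bounded_linear_compose[OF bounded_linear_axis] bounded_linear_jet_s)

text \<open>Injectivity of \<open>e\<close> keeps the slots apart, so one summand survives. The top
  slot receives nothing, hence \<open>k < m\<close>.\<close>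

lemma jet_s_shift:
  assumes "inj_on e {0..m}" "k < m"
  shows "jet_s e k (jet_shift e m p) = jet_s e (Suc k) p"
proof -
  have "jet_s e k (jet_shift e m p) = (\<Sum>j<m. axis (e j) (jet_s e (Suc j) p) $ e k)"
    by (simp add: jet_shift_def jet_s_def)
  also have "\<dots> = (\<Sum>j<m. if j = k then jet_s e (Suc k) p else 0)"
    using assms by (intro sum.cong) (auto simp: axis_def inj_on_eq_iff)
  finally show ?thesis using assms(2) by simp
qed

lemma total_derivative_in_cartan_distribution:
  assumes "inj_on e {0..m}"
  shows "(1, 0) + jet_shift e m p \<in> cartan_distribution e m p"
proof -
  interpret s: bounded_linear "jet_s e k" for k by (rule bounded_linear_jet_s)
  show ?thesis
    using assms
    by (auto simp: cartan_distribution_iff s.add jet_s_shift)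
       (auto simp: jet_s_def jet_theta_def jet_shift_def)
qed

text \<open>The contact forms contain \<open>ds_k\<close> only for \<open>k < m\<close>, so the top
  slot is unconstrained. This is where finite order obstructs involutivity.\<close>

lemma top_axis_in_cartan_distribution:
  assumes "inj_on e {0..m}"
  shows "(0, axis (e m) x) \<in> cartan_distribution e m p"
  using assms by (auto simp: cartan_distribution_iff jet_s_def jet_theta_def axis_def inj_on_eq_iff)

theorem theorem2p2:
  fixes e :: "nat \<Rightarrow> 'n::finite" and m :: nat
  assumes "\<exists>x::'h::{real_inner,banach}. x \<noteq> 0"
    and "m \<ge> 1"
    and "bij_betw e {0..m} UNIV"
  shows "\<not> involutive (cartan_distribution e m :: ('h, 'n) jet \<Rightarrow> ('h, 'n) jet set)
    \<and> ext_d1 (contact_form e (m - 1) :: (('h, 'n) jet, 'h) form1)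
        = wedge (ext_d0 jet_theta) (ext_d0 (jet_s e m))
    \<and> \<not> zero_mod (ext_d1 (contact_form e (m - 1) :: (('h, 'n) jet, 'h) form1)) (contact_forms e m)"
proof (intro conjI)
  obtain x :: 'h where x: "x \<noteq> 0" using assms(1) by blast
  have inj: "inj_on e {0..m}" using assms(3) by (rule bij_betw_imp_inj_on)
  \<comment> \<open>Subtraction on \<open>nat\<close> truncates; \<open>m \<ge> 1\<close> enters
    here.\<close>
  have m: "Suc (m - 1) = m" "m - 1 < m" using assms(2) by auto
  define X :: "('h, 'n) jet \<Rightarrow> ('h, 'n) jet" where "X = (\<lambda>p. (1, 0) + jet_shift e m p)"
  define y :: "('h, 'n) jet" where "y = (0, axis (e m) x)"
  have X: "X p \<in> cartan_distribution e m p" for p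
    unfolding X_def by (rule total_derivative_in_cartan_distribution[OF inj])
  have y: "y \<in> cartan_distribution e m p" for p
    unfolding y_def by (rule top_axis_in_cartan_distribution[OF inj])
  have jet_y: "jet_theta y = 0" "jet_s e m y = x"
    by (simp_all add: y_def jet_theta_def jet_s_def)

  show "\<not> involutive (cartan_distribution e m :: ('h, 'n) jet \<Rightarrow> ('h, 'n) jet set)"
  proof
    assume "involutive (cartan_distribution e m :: ('h, 'n) jet \<Rightarrow> ('h, 'n) jet set)"
    moreover have "smooth_map X"
      unfolding X_def by (rule smooth_map_affine[OF bounded_linear_jet_shift])
    moreover have "smooth_map (\<lambda>_::('h, 'n) jet. y)"
      using smooth_map_affine[OF bounded_linear_zero, of y] by simp
    ultimately have "lie_bracket X (\<lambda>_. y) 0 \<in> cartan_distribution e m 0"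
      using X y unfolding involutive_def by blast
    then have "- jet_shift e m y \<in> cartan_distribution e m 0"
      by (simp add: X_def lie_bracket_affine bounded_linear_jet_shift)
    \<comment> \<open>The bracket has no \<theta>-component, so the kernel equation for
      \<open>k = m - 1\<close> makes this slot vanish, although the shift has moved \<open>x\<close>
      there from the top slot.\<close>
    then have "jet_s e (m - 1) (- jet_shift e m y) = 0"
      using m(2) by (auto simp: cartan_distribution_iff jet_theta_def jet_shift_def)
    then have "jet_s e (m - 1) (jet_shift e m y) = 0"
      by (simp add: jet_s_def)
    then show False
      using x by (simp only: jet_s_shift[OF inj m(2)] m(1) jet_y)
  qed

  show d: "ext_d1 (contact_form e (m - 1) :: (('h, 'n) jet, 'h) form1)
      = wedge (ext_d0 jet_theta) (ext_d0 (jet_s e m))"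
    using ext_d1_contact_form[of e "m - 1"] by (simp only: m(1))

  \<comment> \<open>At the origin \<open>X\<close> is \<open>(1, 0)\<close>. Since
    \<open>d\<theta>\<close> is 1 on it and 0 on \<open>y\<close>, only the top component of
    \<open>y\<close> remains.\<close>
  have "wedge (ext_d0 jet_theta) (ext_d0 (jet_s e m)) 0 (X 0) y = x"
    using jet_y by (simp add: wedge_def blinfun_apply_ext_d0 bounded_linear_jet_theta
        bounded_linear_jet_s) (simp add: jet_theta_def X_def jet_shift_def)
  then show "\<not> zero_mod (ext_d1 (contact_form e (m - 1) :: (('h, 'n) jet, 'h) form1))
      (contact_forms e m)"
    unfolding zero_mod_def d using x X[of 0] y[of 0] by (metis cartan_distribution_def)
qed

end
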